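(* Let $n\ge2$ and $1\le t\le n-1$. The graded algebras $A_t(n,n)$ and $A_{n-t}(n,n)$ are isomorphic.
   Context: $\Bbbk$ is a field of characteristic $0$, $X$ is an $n\times n$ matrix of indeterminates over $\Bbbk$, and $A_t(n,n)$ is the $\Bbbk$-subalgebra of the polynomial ring $\Bbbk[X]$ generated by all $t$-minors of $X$, graded so that each $t$-minor has degree $1$. *)

theory Defs
  imports
    "HOL-Library.Poly_Mapping"
    "Jordan_Normal_Form.Determinant"
    "Jordan_Normal_Form.DL_Submatrix"
begin

text \<open>
  The polynomial ring over \<open>'k\<close> in indeterminates \<open>'v\<close> is the monoid algebra of the
  finitely supported exponent functions.
\<close>

type_synonym ('v, 'k) mpolynomial = "('v \<Rightarrow>\<^sub>0 nat) \<Rightarrow>\<^sub>0 'k"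

definition indet :: "'v \<Rightarrow> ('v, 'k::field) mpolynomial"
  where "indet v = Poly_Mapping.single (Poly_Mapping.single v 1) 1"

definition scale_mpoly :: "'k::field \<Rightarrow> ('v, 'k) mpolynomial \<Rightarrow> ('v, 'k) mpolynomial"
  where "scale_mpoly c p = Poly_Mapping.single 0 c * p"

global_interpretation mpoly: vector_space scale_mpoly
  by unfold_locales
    (simp_all add: scale_mpoly_def distrib_left distrib_right single_add mult_single
      flip: mult.assoc)

definition subalgebra :: "('v, 'k::field) mpolynomial set \<Rightarrow> bool"
  where "subalgebra B \<longleftrightarrow>
    mpoly.subspace B \<and> 1 \<in> B \<and> (\<forall>x\<in>B. \<forall>y\<in>B. x * y \<in> B)"

text \<open>
  The matrix \<open>X\<close> uses only the indeterminates \<open>(i, j)\<close> with \<open>i, j < n\<close> (indices start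
  at 0), so everything below lies in the polynomial subring \<open>'k[X]\<close> generated by these.
\<close>

definition generic_mat :: "nat \<Rightarrow> (nat \<times> nat, 'k::field) mpolynomial mat"
  where "generic_mat n = mat n n indet"

definition minors :: "nat \<Rightarrow> nat \<Rightarrow> (nat \<times> nat, 'k::field) mpolynomial set"
  where "minors n t =
    {det (submatrix (generic_mat n) I J) | I J.
      I \<subseteq> {..<n} \<and> J \<subseteq> {..<n} \<and> card I = t \<and> card J = t}"

definition minor_algebra :: "nat \<Rightarrow> nat \<Rightarrow> (nat \<times> nat, 'k::field) mpolynomial set"
  where "minor_algebra n t = subalgebra hull (minors n t)"

text \<open>
  The grading in which each \<open>t\<close>-minor has degree 1: the component of degree \<open>d\<close> is spanned
  by the products of \<open>d\<close> (not necessarily distinct) \<open>t\<close>-minors. As a subspace of \<open>'k[X]\<close>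
  it consists of forms of ordinary degree \<open>t * d\<close>, so for \<open>t \<ge> 1\<close> the sum over \<open>d\<close> is direct.
\<close>

definition minor_grading :: "nat \<Rightarrow> nat \<Rightarrow> nat \<Rightarrow> (nat \<times> nat, 'k::field) mpolynomial set"
  where "minor_grading n t d =
    mpoly.span {prod_list ms | ms. length ms = d \<and> set ms \<subseteq> minors n t}"

text \<open>
  Isomorphisms of graded \<open>'k\<close>-algebras \<open>A = (\<Oplus>d. G d)\<close> and \<open>B = (\<Oplus>d. H d)\<close> realised as
  subalgebras of polynomial rings. Only the values of \<open>\<phi>\<close> on \<open>A\<close> matter.
\<close>

definition graded_algebra_iso ::
    "(('v, 'k::field) mpolynomial \<Rightarrow> ('w, 'k) mpolynomial) \<Rightarrow>
      ('v, 'k) mpolynomial set \<Rightarrow> (nat \<Rightarrow> ('v, 'k) mpolynomial set) \<Rightarrow>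
      ('w, 'k) mpolynomial set \<Rightarrow> (nat \<Rightarrow> ('w, 'k) mpolynomial set) \<Rightarrow> bool"
  where "graded_algebra_iso \<phi> A G B H \<longleftrightarrow>
    bij_betw \<phi> A B \<and>
    \<phi> 1 = 1 \<and>
    (\<forall>x\<in>A. \<forall>y\<in>A. \<phi> (x + y) = \<phi> x + \<phi> y) \<and>
    (\<forall>x\<in>A. \<forall>y\<in>A. \<phi> (x * y) = \<phi> x * \<phi> y) \<and>
    (\<forall>c. \<forall>x\<in>A. \<phi> (scale_mpoly c x) = scale_mpoly c (\<phi> x)) \<and>
    (\<forall>d. \<phi> ` G d = H d)"

definition graded_algebras_isomorphic ::
    "('v, 'k::field) mpolynomial set \<Rightarrow> (nat \<Rightarrow> ('v, 'k) mpolynomial set) \<Rightarrow>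
      ('w, 'k) mpolynomial set \<Rightarrow> (nat \<Rightarrow> ('w, 'k) mpolynomial set) \<Rightarrow> bool"
  where "graded_algebras_isomorphic A G B H \<longleftrightarrow> (\<exists>\<phi>. graded_algebra_iso \<phi> A G B H)"

end

theory Submission
  imports
    Defs
    "HOL-Library.Product_Lexorder"
begin

text \<open>
  Let \<open>\<delta> = det X\<close>. By Jacobi's identity, the \<open>t\<close>-minor of \<open>adj X\<close> in rows \<open>I\<close> and columns \<open>J\<close> is
  \<open>\<plusminus> \<delta> ^ (t - 1)\<close> times the \<open>(n - t)\<close>-minor of \<open>X\<close> in the rows outside \<open>J\<close> and the columns outside
  \<open>I\<close>. Hence, if a form \<open>F\<close> of degree \<open>d\<close> vanishes on the \<open>t\<close>-minors of \<open>X\<close>, substituting \<open>adj X\<close>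
  for \<open>X\<close> and cancelling \<open>\<delta> ^ (d * (t - 1))\<close> shows that \<open>F\<close> vanishes on the signed complementary
  minors. The sign is the same for complementary index sets, so the argument also runs backwards,
  and sending each minor to its signed complementary minor is an isomorphism. All degrees \<open>d\<close> are
  treated at once by substituting \<open>s * adj X\<close>, with a new variable \<open>s\<close> that records the degree.
\<close>

section \<open>Evaluation of polynomials\<close>

text \<open>The coefficient map \<open>c\<close> allows both targets used below: the field itself,
  and polynomials in one further variable over the polynomial ring.\<close>

definition mpoly_eval :: "('k::field \<Rightarrow> 'b::comm_ring_1) \<Rightarrow> ('v \<Rightarrow> 'b) \<Rightarrow> ('v, 'k) mpolynomial \<Rightarrow> 'b"
  where "mpoly_eval c f p =
    (\<Sum>m\<in>Poly_Mapping.keys p. c (Poly_Mapping.lookup p m) *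
      (\<Prod>v\<in>Poly_Mapping.keys m. f v ^ Poly_Mapping.lookup m v))"

lemma poly_mapping_sum_single:
  "(\<Sum>m\<in>Poly_Mapping.keys p. Poly_Mapping.single m (Poly_Mapping.lookup p m)) = p"
proof (rule poly_mapping_eqI)
  fix k
  have "Poly_Mapping.lookup (\<Sum>m\<in>Poly_Mapping.keys p. Poly_Mapping.single m (Poly_Mapping.lookup p m)) k
    = (\<Sum>m\<in>Poly_Mapping.keys p. if m = k then Poly_Mapping.lookup p m else 0)"
    by (simp add: lookup_sum lookup_single when_def)
  then show "Poly_Mapping.lookup (\<Sum>m\<in>Poly_Mapping.keys p. Poly_Mapping.single m (Poly_Mapping.lookup p m)) k
    = Poly_Mapping.lookup p k"
    by (simp add: in_keys_iff)
qed

lemma monomial_eval_add: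
  fixes f :: "'v \<Rightarrow> 'b::comm_monoid_mult" and m m' :: "'v \<Rightarrow>\<^sub>0 nat"
  shows "(\<Prod>v\<in>Poly_Mapping.keys (m + m'). f v ^ Poly_Mapping.lookup (m + m') v) =
    (\<Prod>v\<in>Poly_Mapping.keys m. f v ^ Poly_Mapping.lookup m v) *
    (\<Prod>v\<in>Poly_Mapping.keys m'. f v ^ Poly_Mapping.lookup m' v)"
proof -
  let ?K = "Poly_Mapping.keys m \<union> Poly_Mapping.keys m'"
  have extend: "(\<Prod>v\<in>Poly_Mapping.keys u. f v ^ Poly_Mapping.lookup u v) = (\<Prod>v\<in>?K. f v ^ Poly_Mapping.lookup u v)"
    if "Poly_Mapping.keys u \<subseteq> ?K" for u
    using that by (intro prod.mono_neutral_left) (auto simp: in_keys_iff)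
  show ?thesis
    by (subst extend[OF Poly_Mapping.keys_add]) (simp add: extend[of m] extend[of m']
        lookup_add power_add prod.distrib)
qed

context
  fixes c :: "'k::field \<Rightarrow> 'b::comm_ring_1" and f :: "'v \<Rightarrow> 'b"
  assumes c: "comm_ring_hom c"
begin

interpretation c: comm_ring_hom c by (rule c)

lemma mpoly_eval_single:
  "mpoly_eval c f (Poly_Mapping.single m a) = c a * (\<Prod>v\<in>Poly_Mapping.keys m. f v ^ Poly_Mapping.lookup m v)"
  by (cases "a = 0") (simp_all add: mpoly_eval_def)

lemma mpoly_eval_indet: "mpoly_eval c f (indet v) = f v"
  by (simp add: indet_def mpoly_eval_single)

lemma mpoly_eval_add: "mpoly_eval c f (p + q) = mpoly_eval c f p + mpoly_eval c f q"
  unfolding mpoly_eval_def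
  by (rule setsum_keys_plus_distrib) (simp_all add: c.hom_add algebra_simps)

lemma mpoly_eval_sum: "mpoly_eval c f (sum g S) = (\<Sum>x\<in>S. mpoly_eval c f (g x))"
proof -
  have "mpoly_eval c f 0 = 0"
    by (simp add: mpoly_eval_def)
  then show ?thesis
    by (induction S rule: infinite_finite_induct) (simp_all add: mpoly_eval_add)
qed

lemma mpoly_eval_mult: "mpoly_eval c f (p * q) = mpoly_eval c f p * mpoly_eval c f q"
proof -
  let ?s = "\<lambda>r m. Poly_Mapping.single m (Poly_Mapping.lookup r m)"
  have "p * q = (\<Sum>m\<in>Poly_Mapping.keys p. ?s p m) * (\<Sum>m\<in>Poly_Mapping.keys q. ?s q m)"
    by (simp only: poly_mapping_sum_single)
  also have "\<dots> = (\<Sum>m\<in>Poly_Mapping.keys p. \<Sum>m'\<in>Poly_Mapping.keys q. ?s p m * ?s q m')"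
    by (rule sum_product)
  finally have "mpoly_eval c f (p * q) =
      (\<Sum>m\<in>Poly_Mapping.keys p. \<Sum>m'\<in>Poly_Mapping.keys q. mpoly_eval c f (?s p m * ?s q m'))"
    by (simp only: mpoly_eval_sum)
  also have "\<dots> = (\<Sum>m\<in>Poly_Mapping.keys p. \<Sum>m'\<in>Poly_Mapping.keys q.
      mpoly_eval c f (?s p m) * mpoly_eval c f (?s q m'))"
    by (simp only: mult_single mpoly_eval_single monomial_eval_add c.hom_mult mult_ac)
  also have "\<dots> = (\<Sum>m\<in>Poly_Mapping.keys p. mpoly_eval c f (?s p m)) *
      (\<Sum>m\<in>Poly_Mapping.keys q. mpoly_eval c f (?s q m))"
    by (rule sum_product[symmetric])
  also have "\<dots> = mpoly_eval c f p * mpoly_eval c f q"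
    by (simp only: poly_mapping_sum_single flip: mpoly_eval_sum)
  finally show ?thesis .
qed

lemma comm_ring_hom_mpoly_eval: "comm_ring_hom (mpoly_eval c f)"
proof
  show "mpoly_eval c f 1 = 1"
    using mpoly_eval_single[of 0 1] by simp
qed (simp_all add: mpoly_eval_add mpoly_eval_mult mpoly_eval_def[of c f 0])

lemma mpoly_eval_scale: "mpoly_eval c f (scale_mpoly a p) = c a * mpoly_eval c f p"
  by (simp add: scale_mpoly_def mpoly_eval_mult mpoly_eval_single)

end

text \<open>Substituting the identity matrix for the generic one sends the determinant to 1.\<close>

lemma det_generic_mat_nonzero: "det (generic_mat n :: (nat \<times> nat, 'k::field) mpolynomial mat) \<noteq> 0"
proof
  assume zero: "det (generic_mat n :: (nat \<times> nat, 'k) mpolynomial mat) = 0"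
  have id: "comm_ring_hom (\<lambda>a::'k. a)"
    by unfold_locales simp_all
  interpret comm_ring_hom "mpoly_eval (\<lambda>a::'k. a) (\<lambda>(i::nat, j). if i = j then 1 else 0)"
    by (rule comm_ring_hom_mpoly_eval[OF id])
  have "map_mat (mpoly_eval (\<lambda>a::'k. a) (\<lambda>(i, j). if i = j then 1 else 0)) (generic_mat n) = 1\<^sub>m n"
    by (rule eq_matI) (simp_all add: generic_mat_def mpoly_eval_indet[OF id])
  then show False
    using zero hom_det[of "generic_mat n"] by simp
qed

section \<open>Jacobi's complementary minor identity\<close>

text \<open>
  Moving the rows \<open>I\<close> and the columns \<open>J\<close> to the front by permutations reduces the identity to
  leading blocks. For \<open>card I = card J\<close> the sign below is \<open>(-1) ^ (\<Sum>I + \<Sum>J)\<close>; the description by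
  permutations makes its invariance under complements a matter of composing with a rotation.
\<close>

definition shuffle_perm :: "nat \<Rightarrow> nat set \<Rightarrow> nat \<Rightarrow> nat"
  where "shuffle_perm n I i =
    (if i < card I then pick I i else if i < n then pick ({..<n} - I) (i - card I) else i)"

definition minor_sign :: "nat \<Rightarrow> nat set \<Rightarrow> nat set \<Rightarrow> int"
  where "minor_sign n I J = sign (shuffle_perm n I) * sign (shuffle_perm n J)"

lemma minor_sign_square: "minor_sign n I J * minor_sign n I J = 1"
  by (simp add: minor_sign_def sign_def)

lemma card_le_of_subset_lessThan: "I \<subseteq> {..<n} \<Longrightarrow> card I \<le> n"
  using card_mono[of "{..<n}" I] by simp

lemma card_complement_lessThan: "I \<subseteq> {..<n} \<Longrightarrow> card ({..<n} - I) = n - card I"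
  by (simp add: card_Diff_subset finite_subset)

lemma pick_eq_iff: "i < card S \<Longrightarrow> j < card S \<Longrightarrow> pick S i = pick S j \<longleftrightarrow> i = j"
  by (metis nat_neq_iff pick_mono)

lemma shuffle_perm_permutes:
  assumes I: "I \<subseteq> {..<n}"
  shows "shuffle_perm n I permutes {0..<n}"
proof (rule bij_imp_permutes)
  note [simp] = card_complement_lessThan[OF I]
  have left: "pick I i \<in> I" if "i < card I" for i
    using that by (simp add: pick_in_set)
  have right: "pick ({..<n} - I) (i - card I) \<in> {..<n} - I" if "\<not> i < card I" "i < n" for i
    using that by (intro pick_in_set) simp
  have "inj_on (shuffle_perm n I) {0..<n}"
  proof (rule inj_onI)
    fix i j
    assume ij: "i \<in> {0..<n}" "j \<in> {0..<n}" and eq: "shuffle_perm n I i = shuffle_perm n I j"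
    consider "i < card I" "j < card I" | "i < card I" "\<not> j < card I"
      | "\<not> i < card I" "j < card I" | "\<not> i < card I" "\<not> j < card I" by blast
    then show "i = j"
    proof cases
      case 1
      then show ?thesis using eq by (simp add: shuffle_perm_def pick_eq_iff)
    next
      case 2
      then show ?thesis using eq ij left[of i] right[of j] by (simp add: shuffle_perm_def)
    next
      case 3
      then show ?thesis using eq ij left[of j] right[of i] by (simp add: shuffle_perm_def)
    next
      case 4
      then have "i - card I = j - card I"
        using eq ij by (subst pick_eq_iff[of _ "{..<n} - I", symmetric]) (auto simp: shuffle_perm_def)
      then show ?thesis using 4 by simp
    qed
  qed
  moreover have "shuffle_perm n I ` {0..<n} \<subseteq> {0..<n}"
    using left right I by (fastforce simp: shuffle_perm_def)
  ultimately show "bij_betw (shuffle_perm n I) {0..<n} {0..<n}"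
    by (simp add: bij_betw_def endo_inj_surj)
  show "shuffle_perm n I i = i" if "i \<notin> {0..<n}" for i
    using that card_le_of_subset_lessThan[OF I] by (auto simp: shuffle_perm_def)
qed

section \<open>The sign under passage to complements\<close>

lemma pick_atLeastLessThan: "i < b - a \<Longrightarrow> pick {a..<b} i = a + i"
proof -
  assume i: "i < b - a"
  then have "{x \<in> {a..<b}. x < a + i} = {a..<a + i}" by auto
  then show ?thesis
    using pick_card_in_set[of "a + i" "{a..<b}"] i by simp
qed

text \<open>Listing the complement before \<open>I\<close> differs from listing \<open>I\<close>
  first by a rotation of the positions. That rotation is itself
  \<open>shuffle_perm n {card I..<n}\<close>, so its sign depends on \<open>I\<close> only through
  \<open>card I\<close>.\<close>

lemma sign_shuffle_perm_complement:
  assumes I: "I \<subseteq> {..<n}"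
  shows "sign (shuffle_perm n ({..<n} - I)) =
    sign (shuffle_perm n I) * sign (shuffle_perm n {card I..<n})"
proof -
  note k = card_le_of_subset_lessThan[OF I]
  have rest: "{..<n} - {card I..<n} = {0..<card I}"
    using k by auto
  have "{..<n} - ({..<n} - I) = I"
    using I by auto
  note complement = this card_complement_lessThan[OF I]
  have "shuffle_perm n ({..<n} - I) = shuffle_perm n I \<circ> shuffle_perm n {card I..<n}"
  proof
    fix i
    consider "i < n - card I" | "n - card I \<le> i" "i < n" | "n \<le> i"
      by linarith
    then show "shuffle_perm n ({..<n} - I) i = (shuffle_perm n I \<circ> shuffle_perm n {card I..<n}) i"
    proof cases
      case 1
      have "shuffle_perm n {card I..<n} i = card I + i"
        using 1 by (simp only: shuffle_perm_def card_atLeastLessThan pick_atLeastLessThan if_True)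
      moreover have "shuffle_perm n I (card I + i) = pick ({..<n} - I) i"
        using less_diff_conv[of i n "card I"] 1 by (simp add: shuffle_perm_def add.commute)
      moreover have "shuffle_perm n ({..<n} - I) i = pick ({..<n} - I) i"
        using 1 by (simp only: shuffle_perm_def complement if_True)
      ultimately show ?thesis by (simp only: o_apply)
    next
      case 2
      \<comment> \<open>The form \<open>card I - 0\<close> matches the length \<open>b - a\<close>
        of the interval starting at 0.\<close>
      have i: "i - (n - card I) < card I - 0" "\<not> i < n - card I" "i - (n - card I) < card I"
        using 2 k by simp_all
      have "shuffle_perm n {card I..<n} i = i - (n - card I)"
        using 2(2) i by (simp only: shuffle_perm_def card_atLeastLessThan rest
            pick_atLeastLessThan[OF i(1)] if_True if_False add_0)
      moreover have "shuffle_perm n I (i - (n - card I)) = pick I (i - (n - card I))"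
        using i by (simp only: shuffle_perm_def if_True)
      moreover have "shuffle_perm n ({..<n} - I) i = pick I (i - (n - card I))"
        using 2(2) i by (simp only: shuffle_perm_def complement if_True if_False)
      ultimately show ?thesis by (simp only: o_apply)
    next
      case 3
      then have "shuffle_perm n K i = i" if "K \<subseteq> {..<n}" for K
        using permutes_not_in[OF shuffle_perm_permutes[OF that]] by simp
      moreover have "{card I..<n} \<subseteq> {..<n}"
        by auto
      ultimately show ?thesis
        using I by simp
    qed
  qed
  moreover have "permutation (shuffle_perm n I)" "permutation (shuffle_perm n {card I..<n})"
    by (rule permutes_imp_permutation[OF finite_atLeastLessThan shuffle_perm_permutes], use I in auto)+
  ultimately show ?thesis
    by (simp add: sign_compose)
qed

text \<open>The two rotations have equal signs because the cardinalities agree, so together they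
  contribute a square, which is 1.\<close>

lemma minor_sign_complement:
  assumes "I \<subseteq> {..<n}" "J \<subseteq> {..<n}" "card I = card J"
  shows "minor_sign n ({..<n} - J) ({..<n} - I) = minor_sign n I J"
proof -
  let ?c = "sign (shuffle_perm n {card J..<n})"
  have "minor_sign n ({..<n} - J) ({..<n} - I) = minor_sign n I J * (?c * ?c)"
    using assms by (simp add: minor_sign_def sign_shuffle_perm_complement mult_ac)
  then show ?thesis
    by (simp add: sign_def)
qed

section \<open>Complementary blocks and minors\<close>

lemma det_permute_rows_cols:
  assumes A: "A \<in> carrier_mat n n" and p: "p permutes {0..<n}" and q: "q permutes {0..<n}"
  shows "det (mat n n (\<lambda>(i, j). A $$ (p i, q j))) = of_int (sign p) * of_int (sign q) * det A"
proof -
  let ?R = "mat n n (\<lambda>(i, j). A $$ (p i, j))"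
  have q_less: "q j < n" if "j < n" for j
    using permutes_in_image[OF q, of j] that by simp
  have "det (mat n n (\<lambda>(i, j). A $$ (p i, q j))) = det (mat n n (\<lambda>(i, j). ?R\<^sup>T $$ (q i, j)))\<^sup>T"
    by (rule arg_cong[of _ _ det], rule eq_matI) (simp_all add: q_less)
  also have "\<dots> = det (mat n n (\<lambda>(i, j). ?R\<^sup>T $$ (q i, j)))"
    by (rule det_transpose[of _ n]) simp
  also have "\<dots> = signof q * det ?R\<^sup>T"
    by (rule det_permute_rows[OF _ q]) simp
  also have "det ?R\<^sup>T = det ?R"
    by (rule det_transpose[of _ n]) simp
  also have "det ?R = signof p * det A"
    by (rule det_permute_rows[OF A p])
  finally show ?thesis by (simp add: mult_ac)
qed

text \<open>Replace all but the first \<open>t\<close> columns of \<open>D\<close> by identity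
  columns. Multiplying by \<open>B\<close> on the left gives the first \<open>t\<close> columns of
  \<open>\<delta>\<close> times the identity, followed by the last columns of \<open>B\<close>. Both
  matrices are block triangular, and comparing determinants gives the claim.\<close>

lemma det_complementary_block:
  fixes B D :: "'a::idom mat"
  assumes B: "B \<in> carrier_mat n n" and D: "D \<in> carrier_mat n n"
    and BD: "B * D = \<delta> \<cdot>\<^sub>m 1\<^sub>m n" and t: "t \<le> n"
  shows "det B * det (mat t t (\<lambda>(i, j). D $$ (i, j))) =
    \<delta> ^ t * det (mat (n - t) (n - t) (\<lambda>(i, j). B $$ (i + t, j + t)))"
proof -
  let ?D11 = "mat t t (\<lambda>(i, j). D $$ (i, j))"
  let ?D21 = "mat (n - t) t (\<lambda>(i, j). D $$ (i + t, j))"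
  let ?B12 = "mat t (n - t) (\<lambda>(i, j). B $$ (i, j + t))"
  let ?B22 = "mat (n - t) (n - t) (\<lambda>(i, j). B $$ (i + t, j + t))"
  let ?M = "four_block_mat ?D11 (0\<^sub>m t (n - t)) ?D21 (1\<^sub>m (n - t))"
  let ?N = "four_block_mat (\<delta> \<cdot>\<^sub>m 1\<^sub>m t) ?B12 (0\<^sub>m (n - t) t) ?B22"
  have M: "?M \<in> carrier_mat n n"
    using t by auto
  \<comment> \<open>The first \<open>t\<close> columns of \<open>?M\<close> are those of \<open>D\<close>, the others are those of the identity.\<close>
  have "B * ?M = ?N"
  proof (rule eq_matI)
    fix i j
    assume "i < dim_row ?N" "j < dim_col ?N"
    then have i: "i < n" and j: "j < n"
      using t by auto
    have prod: "(B * ?M) $$ (i, j) = (\<Sum>k = 0..<n. B $$ (i, k) * ?M $$ (k, j))"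
      using B M i j t by (simp add: times_mat_def scalar_prod_def)
    show "(B * ?M) $$ (i, j) = ?N $$ (i, j)"
    proof (cases "j < t")
      case True
      have "(B * ?M) $$ (i, j) = (\<Sum>k = 0..<n. B $$ (i, k) * D $$ (k, j))"
        unfolding prod using True t by (intro sum.cong) auto
      also have "\<dots> = (B * D) $$ (i, j)"
        using B D i j by (simp add: times_mat_def scalar_prod_def)
      finally show ?thesis
        using True i j t by (auto simp: BD)
    next
      case False
      have "(B * ?M) $$ (i, j) = (\<Sum>k = 0..<n. if k = j then B $$ (i, k) else 0)"
        unfolding prod using False j t by (intro sum.cong) auto
      then show ?thesis
        using False i j t by simp
    qed
  qed (use B t in auto)
  then have "det B * det ?M = det ?N"
    using det_mult[OF B M] by simp
  moreover have "det ?M = det ?D11 * det (1\<^sub>m (n - t))"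
    by (rule det_four_block_mat_upper_right_zero[of _ t _ "n - t"]) auto
  moreover have "det ?N = det (\<delta> \<cdot>\<^sub>m 1\<^sub>m t) * det ?B22"
    by (rule det_four_block_mat_lower_left_zero[of _ t _ "n - t"]) auto
  ultimately show ?thesis by simp
qed

lemma submatrix_eq_pick:
  assumes "A \<in> carrier_mat n n" "I \<subseteq> {..<n}" "J \<subseteq> {..<n}"
  shows "submatrix A I J = mat (card I) (card J) (\<lambda>(i, j). A $$ (pick I i, pick J j))"
proof -
  have "{i. i < n \<and> i \<in> I} = I" "{j. j < n \<and> j \<in> J} = J"
    using assms by auto
  then show ?thesis
    using assms(1) by (auto simp: submatrix_def)
qed

lemma det_complementary_minor:
  fixes A C :: "'a::idom mat"
  assumes A: "A \<in> carrier_mat n n" and C: "C \<in> carrier_mat n n"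
    and AC: "A * C = \<delta> \<cdot>\<^sub>m 1\<^sub>m n"
    and I: "I \<subseteq> {..<n}" "card I = t" and J: "J \<subseteq> {..<n}" "card J = t"
  shows "det A * det (submatrix C I J) =
    of_int (minor_sign n I J) * \<delta> ^ t * det (submatrix A ({..<n} - J) ({..<n} - I))"
proof -
  let ?p = "shuffle_perm n I" and ?q = "shuffle_perm n J"
  \<comment> \<open>The inner index is permuted by \<open>?p\<close> in both factors, which only
    reorders the sum, and applying \<open>?q\<close> to rows and columns alike preserves a scalar
    matrix. Hence \<open>?B * ?D\<close> is again scalar.\<close>
  let ?B = "mat n n (\<lambda>(i, j). A $$ (?q i, ?p j))" and ?D = "mat n n (\<lambda>(i, j). C $$ (?p i, ?q j))"
  have t: "t \<le> n"
    using card_le_of_subset_lessThan I by blast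
  note p = shuffle_perm_permutes[OF I(1)] and q = shuffle_perm_permutes[OF J(1)]
  have less: "?p i < n" "?q i < n" if "i < n" for i
    using permutes_in_image[OF p, of i] permutes_in_image[OF q, of i] that by simp_all
  have "?B * ?D = \<delta> \<cdot>\<^sub>m 1\<^sub>m n"
  proof (rule eq_matI)
    fix i j
    assume "i < dim_row (\<delta> \<cdot>\<^sub>m 1\<^sub>m n)" "j < dim_col (\<delta> \<cdot>\<^sub>m 1\<^sub>m n)"
    then have i: "i < n" and j: "j < n" by auto
    have "(?B * ?D) $$ (i, j) = (\<Sum>k = 0..<n. A $$ (?q i, ?p k) * C $$ (?p k, ?q j))"
      using i j by (simp add: scalar_prod_def)
    also have "\<dots> = (\<Sum>k = 0..<n. A $$ (?q i, k) * C $$ (k, ?q j))"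
      using sum.permute[OF p, of "\<lambda>k. A $$ (?q i, k) * C $$ (k, ?q j)"] by (simp add: o_def)
    also have "\<dots> = (A * C) $$ (?q i, ?q j)"
      using A C i j less by (simp add: times_mat_def scalar_prod_def)
    finally show "(?B * ?D) $$ (i, j) = (\<delta> \<cdot>\<^sub>m 1\<^sub>m n) $$ (i, j)"
      using i j less permutes_inj[OF q] by (auto simp: AC inj_eq)
  qed simp_all
  from det_complementary_block[OF _ _ this t]
  have "det ?B * det (mat t t (\<lambda>(i, j). ?D $$ (i, j))) =
      \<delta> ^ t * det (mat (n - t) (n - t) (\<lambda>(i, j). ?B $$ (i + t, j + t)))"
    by simp
  also have "mat t t (\<lambda>(i, j). ?D $$ (i, j)) = submatrix C I J"
    using t I J by (auto simp: submatrix_eq_pick[OF C] shuffle_perm_def)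
  also have "mat (n - t) (n - t) (\<lambda>(i, j). ?B $$ (i + t, j + t)) = submatrix A ({..<n} - J) ({..<n} - I)"
  proof -
    have "i + t < n" if "i < n - t" for i
      using that by simp
    then show ?thesis
      using I J by (intro eq_matI)
        (simp_all add: submatrix_eq_pick[OF A] card_complement_lessThan shuffle_perm_def)
  qed
  finally have "of_int (sign ?q) * of_int (sign ?p) * det A * det (submatrix C I J) =
      \<delta> ^ t * det (submatrix A ({..<n} - J) ({..<n} - I))"
    by (simp add: det_permute_rows_cols[OF A q p])
  then have "of_int (minor_sign n I J) * (of_int (minor_sign n I J) * (det A * det (submatrix C I J))) =
      of_int (minor_sign n I J) * (\<delta> ^ t * det (submatrix A ({..<n} - J) ({..<n} - I)))"
    by (simp add: minor_sign_def mult_ac)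
  moreover have "of_int (minor_sign n I J) * (of_int (minor_sign n I J) * x) = x" for x :: 'a
    by (simp add: minor_sign_square flip: of_int_mult mult.assoc)
  ultimately show ?thesis
    by (simp add: mult.assoc)
qed

text \<open>The case \<open>\<delta> = det A\<close> of the previous identity; cancelling one factor
  \<open>det A\<close> lowers the exponent from \<open>Suc t\<close> to \<open>t\<close>.\<close>

lemma det_submatrix_adj_mat:
  fixes A :: "'a::idom mat"
  assumes A: "A \<in> carrier_mat n n" and nonzero: "det A \<noteq> 0"
    and I: "I \<subseteq> {..<n}" "card I = Suc t" and J: "J \<subseteq> {..<n}" "card J = Suc t"
  shows "det (submatrix (adj_mat A) I J) =
    of_int (minor_sign n I J) * det A ^ t * det (submatrix A ({..<n} - J) ({..<n} - I))"
proof -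
  have "det A * det (submatrix (adj_mat A) I J) =
    det A * (of_int (minor_sign n I J) * det A ^ t * det (submatrix A ({..<n} - J) ({..<n} - I)))"
    using det_complementary_minor[OF A adj_mat(1,2)[OF A] I J] by (simp add: mult_ac)
  then show ?thesis
    using nonzero by simp
qed

section \<open>The correspondence between the two minor algebras\<close>

abbreviation generic_minor :: "nat \<Rightarrow> nat set \<Rightarrow> nat set \<Rightarrow> (nat \<times> nat, 'k::field) mpolynomial"
  where "generic_minor n I J \<equiv> det (submatrix (generic_mat n) I J)"

text \<open>The graph of the future isomorphism: the algebra of pairs generated by each minor with
  its signed complementary minor. Starting from a relation postpones well-definedness to a proof
  that partners are unique. Rows and columns trade places because the adjugate involves a
  transpose.\<close>

inductive minor_rel :: "nat \<Rightarrow> nat \<Rightarrow> (nat \<times> nat, 'k::field) mpolynomial \<Rightarrow>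
    (nat \<times> nat, 'k) mpolynomial \<Rightarrow> bool"
  for n t where
  one: "minor_rel n t 1 1"
| minor: "I \<subseteq> {..<n} \<Longrightarrow> J \<subseteq> {..<n} \<Longrightarrow> card I = t \<Longrightarrow> card J = t \<Longrightarrow>
    minor_rel n t (generic_minor n I J)
      (scale_mpoly (of_int (minor_sign n I J)) (generic_minor n ({..<n} - J) ({..<n} - I)))"
| add: "minor_rel n t p q \<Longrightarrow> minor_rel n t p' q' \<Longrightarrow> minor_rel n t (p + p') (q + q')"
| mult: "minor_rel n t p q \<Longrightarrow> minor_rel n t p' q' \<Longrightarrow> minor_rel n t (p * p') (q * q')"
| scale: "minor_rel n t p q \<Longrightarrow> minor_rel n t (scale_mpoly c p) (scale_mpoly c q)"

section \<open>Substituting \<open>s\<close> times the adjugate\<close>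

lemma comm_ring_hom_const_poly:
  "comm_ring_hom (\<lambda>a::'k::field. [:Poly_Mapping.single (0::'v \<Rightarrow>\<^sub>0 nat) a:])"
  by unfold_locales (simp_all add: single_add mult_single one_pCons mult.commute)

text \<open>The variable of the outer \<open>poly\<close> plays the role of \<open>s\<close>; its
  exponent records the ordinary degree of a form.\<close>

definition adj_eval :: "nat \<Rightarrow> (nat \<times> nat, 'k::field) mpolynomial \<Rightarrow> (nat \<times> nat, 'k) mpolynomial poly"
  where "adj_eval n = mpoly_eval (\<lambda>a. [:Poly_Mapping.single 0 a:])
    (\<lambda>ij. monom (adj_mat (generic_mat n) $$ ij) 1)"

lemma comm_ring_hom_adj_eval: "comm_ring_hom (adj_eval n :: (nat \<times> nat, 'k::field) mpolynomial \<Rightarrow> _)"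
  unfolding adj_eval_def by (rule comm_ring_hom_mpoly_eval[OF comm_ring_hom_const_poly])

lemma scale_mpoly_of_int: "scale_mpoly (of_int a) p = of_int a * p"
  by (simp add: scale_mpoly_def)

text \<open>
  The polynomial ring is an instance of \<^class>\<open>idom\<close> only because the indeterminates \<open>(i, j)\<close> are
  linearly ordered by \<^theory>\<open>HOL-Library.Product_Lexorder\<close>.
\<close>

lemma adj_eval_minor:
  assumes I: "I \<subseteq> {..<n}" "card I = Suc t" and J: "J \<subseteq> {..<n}" "card J = Suc t"
  shows "adj_eval n (generic_minor n I J :: (nat \<times> nat, 'k::field) mpolynomial) =
    monom (det (generic_mat n) ^ t *
      scale_mpoly (of_int (minor_sign n I J)) (generic_minor n ({..<n} - J) ({..<n} - I))) (Suc t)"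
proof -
  interpret ev: comm_ring_hom "adj_eval n :: (nat \<times> nat, 'k) mpolynomial \<Rightarrow> _"
    by (rule comm_ring_hom_adj_eval)
  interpret const: comm_ring_hom "\<lambda>a::(nat \<times> nat, 'k) mpolynomial. [:a:]"
    by unfold_locales (simp_all add: one_pCons)
  let ?X = "generic_mat n :: (nat \<times> nat, 'k) mpolynomial mat"
  have X: "?X \<in> carrier_mat n n"
    by (simp add: generic_mat_def)
  have less: "pick I i < n" "pick J i < n" if "i < Suc t" for i
    using that I J pick_in_set[of i I] pick_in_set[of i J] by auto
  have entry: "adj_eval n (?X $$ (i, j)) = monom 1 1 * [:adj_mat ?X $$ (i, j):]"
    if "i < n" "j < n" for i j
    using that mpoly_eval_indet[OF comm_ring_hom_const_poly, where v = "(i, j)"]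
    by (simp add: generic_mat_def adj_eval_def mult_monom mult.commute[of "monom 1 _"] smult_monom)
  \<comment> \<open>Every entry acquires a factor \<open>s\<close>, so the determinant of this
    matrix of size \<open>Suc t\<close> acquires \<open>s ^ Suc t\<close>.\<close>
  have "map_mat (adj_eval n) (submatrix ?X I J) =
    monom 1 1 \<cdot>\<^sub>m map_mat (\<lambda>a. [:a:]) (submatrix (adj_mat ?X) I J)"
    unfolding submatrix_eq_pick[OF X I(1) J(1)] submatrix_eq_pick[OF adj_mat(1)[OF X] I(1) J(1)]
    by (rule eq_matI) (simp_all add: I J less entry)
  from arg_cong[OF this, of det]
  have "adj_eval n (det (submatrix ?X I J)) = monom 1 1 ^ Suc t * [:det (submatrix (adj_mat ?X) I J):]"
    unfolding ev.hom_det det_smult const.hom_det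
    by (simp only: submatrix_eq_pick[OF adj_mat(1)[OF X] I(1) J(1)] dim_col_mat index_map_mat J(2))
  also have "\<dots> = monom (det (submatrix (adj_mat ?X) I J)) (Suc t)"
    by (simp add: monom_power mult_monom del: power_Suc flip: monom_0)
  also have "det (submatrix (adj_mat ?X) I J) = det ?X ^ t *
      scale_mpoly (of_int (minor_sign n I J)) (generic_minor n ({..<n} - J) ({..<n} - I))"
    unfolding det_submatrix_adj_mat[OF X det_generic_mat_nonzero I J] scale_mpoly_of_int
    by (simp only: mult_ac)
  finally show ?thesis .
qed

text \<open>The variable of \<open>Q\<close> marks each minor used in building \<open>q\<close>, and
  setting it to 1 recovers \<open>q\<close>. By Jacobi's identity each minor in \<open>p\<close>
  contributes the same monomial, \<open>det X ^ t * s ^ Suc t\<close>, so replacing the marker by it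
  yields \<open>adj_eval n p\<close>. Composition and evaluation are ring homomorphisms, so the
  property passes to sums and products.\<close>

lemma minor_rel_adj_eval:
  assumes "minor_rel n (Suc t) p (q :: (nat \<times> nat, 'k::field) mpolynomial)"
  shows "\<exists>Q. adj_eval n p = Q \<circ>\<^sub>p monom (det (generic_mat n) ^ t) (Suc t) \<and> poly Q 1 = q"
proof -
  interpret ev: comm_ring_hom "adj_eval n :: (nat \<times> nat, 'k) mpolynomial \<Rightarrow> _"
    by (rule comm_ring_hom_adj_eval)
  from assms show ?thesis
  proof induction
    case one
    show ?case
      by (intro exI[of _ 1]) (simp add: pcompose_1)
  next
    case (minor I J)
    then show ?case
      \<comment> \<open>A single minor has degree 1, so the witness is its partner times the
        marker.\<close>
      by (intro exI[of _ "monom (scale_mpoly (of_int (minor_sign n I J))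
          (generic_minor n ({..<n} - J) ({..<n} - I))) 1"])
        (simp add: adj_eval_minor poly_monom monom_Suc monom_0 pcompose_pCons mult.commute smult_monom)
  next
    case (add p q p' q')
    then obtain Q Q' where
      "adj_eval n p = Q \<circ>\<^sub>p monom (det (generic_mat n) ^ t) (Suc t)" "poly Q 1 = q"
      "adj_eval n p' = Q' \<circ>\<^sub>p monom (det (generic_mat n) ^ t) (Suc t)" "poly Q' 1 = q'"
      by blast
    then show ?case
      by (intro exI[of _ "Q + Q'"]) (simp add: ev.hom_add pcompose_add)
  next
    case (mult p q p' q')
    then obtain Q Q' where
      "adj_eval n p = Q \<circ>\<^sub>p monom (det (generic_mat n) ^ t) (Suc t)" "poly Q 1 = q"
      "adj_eval n p' = Q' \<circ>\<^sub>p monom (det (generic_mat n) ^ t) (Suc t)" "poly Q' 1 = q'"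
      by blast
    then show ?case
      by (intro exI[of _ "Q * Q'"]) (simp add: ev.hom_mult pcompose_mult)
  next
    case (scale p q c)
    then obtain Q where
      "adj_eval n p = Q \<circ>\<^sub>p monom (det (generic_mat n) ^ t) (Suc t)" "poly Q 1 = q"
      by blast
    then show ?case
      by (intro exI[of _ "smult (Poly_Mapping.single 0 c) Q"])
        (simp add: adj_eval_def mpoly_eval_scale[OF comm_ring_hom_const_poly] pcompose_smult
          scale_mpoly_def[of _ q])
  qed
qed

section \<open>Uniqueness of partners and symmetry\<close>

lemma minor_rel_diff:
  assumes "minor_rel n t p q" "minor_rel n t p' q'"
  shows "minor_rel n t (p - p') (q - q')"
proof -
  have "scale_mpoly (- 1) r = - r" for r :: "('v, 'k::field) mpolynomial"
    by (simp add: scale_mpoly_def single_uminus)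
  then show ?thesis
    using minor_rel.add[OF assms(1) minor_rel.scale[OF assms(2), of "- 1"]] by simp
qed

text \<open>Two partners of \<open>p\<close> differ by a partner of 0, whose marked polynomial
  \<open>Q\<close> becomes 0 after composition with a nonconstant polynomial. Over an integral
  domain this forces \<open>Q = 0\<close>, so the difference, the value of \<open>Q\<close> at 1,
  vanishes.\<close>

lemma minor_rel_unique:
  fixes p q q' :: "(nat \<times> nat, 'k::field) mpolynomial"
  assumes "1 \<le> t" "minor_rel n t p q" "minor_rel n t p q'"
  shows "q = q'"
proof -
  interpret ev: comm_ring_hom "adj_eval n :: (nat \<times> nat, 'k) mpolynomial \<Rightarrow> _"
    by (rule comm_ring_hom_adj_eval)
  obtain s where t: "t = Suc s"
    using assms(1) by (cases t) simp_all
  have "minor_rel n (Suc s) 0 (q - q')"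
    using minor_rel_diff[OF assms(2,3)] by (simp add: t)
  from minor_rel_adj_eval[OF this] obtain Q where
    Q: "Q \<circ>\<^sub>p monom (det (generic_mat n) ^ s) (Suc s) = 0" "poly Q 1 = q - q'"
    by auto
  have "degree (monom (det (generic_mat n :: (nat \<times> nat, 'k) mpolynomial mat) ^ s) (Suc s)) > 0"
    by (simp add: degree_monom_eq det_generic_mat_nonzero)
  with Q(1) have "Q = 0"
    by (rule pcompose_eq_0)
  with Q(2) show ?thesis by simp
qed

text \<open>Taking complements twice restores the index sets, and the complementary pair has the
  same sign, which squares to 1. Only the generators need this argument; the other rules are
  symmetric.\<close>

lemma minor_rel_sym:
  assumes "t \<le> n" "minor_rel n t p (q :: (nat \<times> nat, 'k::field) mpolynomial)"
  shows "minor_rel n (n - t) q p"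
  using assms(2)
proof induction
  case (minor I J)
  let ?e = "of_int (minor_sign n I J) :: 'k"
  have "{..<n} - ({..<n} - I) = I" "{..<n} - ({..<n} - J) = J"
    using minor by auto
  then have "minor_rel n (n - t) (generic_minor n ({..<n} - J) ({..<n} - I) :: (_, 'k) mpolynomial)
      (scale_mpoly ?e (generic_minor n I J))"
    using minor_rel.minor[of "{..<n} - J" n "{..<n} - I" "n - t"] minor
    by (simp add: card_complement_lessThan minor_sign_complement)
  from minor_rel.scale[OF this, of ?e] show ?case
    by (simp add: minor_sign_square flip: of_int_mult)
qed (simp_all add: minor_rel.intros)

lemma minor_rel_zero: "minor_rel n t 0 0"
  using minor_rel.scale[OF minor_rel.one, of n t 0] by simp

section \<open>Compatibility with the gradings\<close>

lemma minor_times_minor_grading: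
  assumes m: "m \<in> minors n t" and p: "p \<in> minor_grading n t d"
  shows "m * p \<in> minor_grading n t (Suc d)"
  using p unfolding minor_grading_def
proof (induction rule: mpoly.span_induct)
  case base
  have "m * scale_mpoly c x = scale_mpoly c (m * x)" for c x
    by (simp add: scale_mpoly_def mult_ac)
  then show ?case
    by (simp add: mpoly.subspace_def distrib_left mpoly.span_zero mpoly.span_add mpoly.span_scale)
next
  case (step x)
  then obtain ms where "x = prod_list ms" "length ms = d" "set ms \<subseteq> minors n t"
    by blast
  with m have "m * x = prod_list (m # ms)" "length (m # ms) = Suc d" "set (m # ms) \<subseteq> minors n t"
    by simp_all
  then show ?case
    by (intro mpoly.span_base) blast
qed

lemma minor_rel_prod_list:
  fixes ms :: "(nat \<times> nat, 'k::field) mpolynomial list"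
  assumes "set ms \<subseteq> minors n t"
  shows "\<exists>q \<in> minor_grading n (n - t) (length ms). minor_rel n t (prod_list ms) q"
  using assms
proof (induction ms)
  case Nil
  have "(1 :: (nat \<times> nat, 'k) mpolynomial) \<in> minor_grading n (n - t) 0"
    unfolding minor_grading_def by (rule mpoly.span_base) simp
  then show ?case
    using minor_rel.one by auto
next
  case (Cons m ms)
  then obtain q where q: "q \<in> minor_grading n (n - t) (length ms)" "minor_rel n t (prod_list ms) q"
    by auto
  obtain I J where IJ: "m = generic_minor n I J" "I \<subseteq> {..<n}" "J \<subseteq> {..<n}" "card I = t" "card J = t"
    using Cons.prems by (auto simp: minors_def)
  let ?c = "of_int (minor_sign n I J) :: 'k" 
    and ?m = "generic_minor n ({..<n} - J) ({..<n} - I) :: (nat \<times> nat, 'k) mpolynomial"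
  have "?m \<in> minors n (n - t)"
    unfolding minors_def using IJ
    by (intro CollectI exI[of _ "{..<n} - J"] exI[of _ "{..<n} - I"])
      (simp add: card_complement_lessThan)
  then have "?m * q \<in> minor_grading n (n - t) (Suc (length ms))"
    using q(1) by (rule minor_times_minor_grading)
  then have "scale_mpoly ?c ?m * q \<in> minor_grading n (n - t) (Suc (length ms))"
    \<comment> \<open>Rebracketing moves the scalar outside the whole product, where the span
      absorbs it.\<close>
    unfolding minor_grading_def scale_mpoly_def mult.assoc
    unfolding scale_mpoly_def[symmetric] by (rule mpoly.span_scale)
  moreover have "minor_rel n t (m * prod_list ms) (scale_mpoly ?c ?m * q)"
    unfolding IJ(1) by (rule minor_rel.mult[OF minor_rel.minor[OF IJ(2-5)] q(2)])
  ultimately show ?case by auto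
qed

text \<open>The elements with a partner in degree \<open>d\<close> form a subspace, so products of
  \<open>d\<close> minors suffice.\<close>

lemma minor_rel_in_grading:
  fixes p :: "(nat \<times> nat, 'k::field) mpolynomial"
  assumes "p \<in> minor_grading n t d"
  shows "\<exists>q \<in> minor_grading n (n - t) d. minor_rel n t p q"
  using assms unfolding minor_grading_def[of n t]
proof (induction rule: mpoly.span_induct)
  case base
  let ?S = "{p. \<exists>q \<in> minor_grading n (n - t) d. minor_rel n t p (q :: (nat \<times> nat, 'k) mpolynomial)}"
  have "0 \<in> ?S"
    using minor_rel_zero mpoly.span_zero unfolding minor_grading_def by blast
  moreover have "x + y \<in> ?S" if "x \<in> ?S" "y \<in> ?S" for x y
    using that minor_rel.add mpoly.span_add unfolding minor_grading_def by blast
  moreover have "scale_mpoly c x \<in> ?S" if "x \<in> ?S" for c x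
    using that minor_rel.scale mpoly.span_scale unfolding minor_grading_def by blast
  ultimately show ?case
    by (intro mpoly.subspaceI)
next
  case (step x)
  then show ?case
    using minor_rel_prod_list by blast
qed

section \<open>From the relation to the isomorphism\<close>

text \<open>The domain of the relation is a subalgebra containing the minors, and induction over the
  relation places it inside every such subalgebra.\<close>

lemma minor_algebra_eq:
  "minor_algebra n t = {p. \<exists>q. minor_rel n t p (q :: (nat \<times> nat, 'k::field) mpolynomial)}"
    (is "_ = ?A")
proof
  have "0 \<in> ?A" "1 \<in> ?A"
    using minor_rel_zero minor_rel.one by blast+
  moreover have "x + y \<in> ?A" "x * y \<in> ?A" "scale_mpoly c x \<in> ?A" if "x \<in> ?A" "y \<in> ?A" for x y c
    using that by (blast intro: minor_rel.add minor_rel.mult minor_rel.scale)+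
  ultimately have "subalgebra ?A"
    unfolding subalgebra_def mpoly.subspace_def by simp
  moreover have "minors n t \<subseteq> ?A"
    using minor_rel.minor unfolding minors_def by blast
  ultimately show "minor_algebra n t \<subseteq> ?A"
    unfolding minor_algebra_def by (intro hull_minimal) auto
  have "p \<in> B" if "minor_rel n t p q" and B: "subalgebra B" "minors n t \<subseteq> B"
    for p q and B :: "(nat \<times> nat, 'k) mpolynomial set"
    using that(1)
  proof induction
    case (minor I J)
    then show ?case using B(2) unfolding minors_def by blast
  qed (use B(1) in \<open>simp_all add: subalgebra_def mpoly.subspace_def\<close>)
  then show "?A \<subseteq> minor_algebra n t"
    unfolding minor_algebra_def hull_def by blast
qed

text \<open>A relation single-valued in both directions is the graph of a bijection, and its closure
  under the operations makes that bijection a homomorphism.\<close>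

lemma graded_algebras_isomorphic_of_rel:
  fixes R :: "('v, 'k::field) mpolynomial \<Rightarrow> ('w, 'k) mpolynomial \<Rightarrow> bool"
  assumes A: "\<And>p. p \<in> A \<longleftrightarrow> (\<exists>q. R p q)" and B: "\<And>q. q \<in> B \<longleftrightarrow> (\<exists>p. R p q)"
    and right_unique: "\<And>p q q'. R p q \<Longrightarrow> R p q' \<Longrightarrow> q = q'"
    and left_unique: "\<And>p p' q. R p q \<Longrightarrow> R p' q \<Longrightarrow> p = p'"
    and one: "R 1 1"
    and add: "\<And>p q p' q'. R p q \<Longrightarrow> R p' q' \<Longrightarrow> R (p + p') (q + q')"
    and mult: "\<And>p q p' q'. R p q \<Longrightarrow> R p' q' \<Longrightarrow> R (p * p') (q * q')"
    and scale: "\<And>p q c. R p q \<Longrightarrow> R (scale_mpoly c p) (scale_mpoly c q)"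
    and G: "\<And>d p. p \<in> G d \<Longrightarrow> \<exists>q \<in> H d. R p q" and H: "\<And>d q. q \<in> H d \<Longrightarrow> \<exists>p \<in> G d. R p q"
  shows "graded_algebras_isomorphic A G B H"
proof -
  \<comment> \<open>Outside \<open>A\<close> the value is unspecified, which is harmless since only
    values on \<open>A\<close> are constrained.\<close>
  define \<phi> where "\<phi> p = (THE q. R p q)" for p
  have \<phi>: "\<phi> p = q" if "R p q" for p q
    unfolding \<phi>_def using that right_unique by blast
  have R: "R p (\<phi> p)" if "p \<in> A" for p
    using that A \<phi> by metis
  have "graded_algebra_iso \<phi> A G B H"
    unfolding graded_algebra_iso_def
  proof (intro conjI ballI allI)
    show "bij_betw \<phi> A B"
    proof (rule bij_betw_imageI)
      show "inj_on \<phi> A"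
      proof (rule inj_onI)
        fix p p'
        assume "p \<in> A" "p' \<in> A" and eq: "\<phi> p = \<phi> p'"
        then obtain q q' where "R p q" "R p' q'"
          using A by blast
        with eq show "p = p'"
          using \<phi> left_unique by metis
      qed
      show "\<phi> ` A = B"
        using \<phi> A B by (force simp: image_iff)
    qed
    show "\<phi> 1 = 1"
      by (rule \<phi>[OF one])
    show "\<phi> ` G d = H d" for d
      unfolding image_def using \<phi> G H by blast
  qed (simp_all add: \<phi> R add mult scale)
  then show ?thesis
    unfolding graded_algebras_isomorphic_def by blast
qed

theorem proposition1p3:
  fixes n t :: nat
  assumes "n \<ge> 2" and "1 \<le> t" and "t \<le> n - 1"
  shows "graded_algebras_isomorphic
    (minor_algebra n t :: (nat \<times> nat, 'k::field_char_0) mpolynomial set)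
    (minor_grading n t)
    (minor_algebra n (n - t) :: (nat \<times> nat, 'k) mpolynomial set)
    (minor_grading n (n - t))"
proof (rule graded_algebras_isomorphic_of_rel[where R = "minor_rel n t"])
  have t: "t \<le> n" "n - t \<le> n" "n - (n - t) = t" "1 \<le> n - t"
    using assms by auto
  \<comment> \<open>Exchanging \<open>t\<close> with \<open>n - t\<close> reverses the relation, so
    surjectivity, uniqueness of preimages and the second grading condition follow from the facts on
    the domain side.\<close>
  have sym: "minor_rel n t p q \<longleftrightarrow> minor_rel n (n - t) q p" for p q :: "(nat \<times> nat, 'k) mpolynomial"
    using minor_rel_sym[of t n p q] minor_rel_sym[of "n - t" n q p] t by auto
  show "p \<in> minor_algebra n t \<longleftrightarrow> (\<exists>q. minor_rel n t p q)" for p :: "(nat \<times> nat, 'k) mpolynomial"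
    by (simp add: minor_algebra_eq)
  show "q \<in> minor_algebra n (n - t) \<longleftrightarrow> (\<exists>p. minor_rel n t p q)" for q :: "(nat \<times> nat, 'k) mpolynomial"
    by (simp add: minor_algebra_eq sym)
  show "q = q'" if "minor_rel n t p q" "minor_rel n t p q'" for p q q' :: "(nat \<times> nat, 'k) mpolynomial"
    using minor_rel_unique[OF assms(2) that] .
  show "p = p'" if "minor_rel n t p q" "minor_rel n t p' q" for p p' q :: "(nat \<times> nat, 'k) mpolynomial"
    using that minor_rel_unique[OF t(4)] unfolding sym by blast
  show "\<exists>q \<in> minor_grading n (n - t) d. minor_rel n t p q" if "p \<in> minor_grading n t d"
    for d and p :: "(nat \<times> nat, 'k) mpolynomial"
    using that by (rule minor_rel_in_grading)
  show "\<exists>p \<in> minor_grading n t d. minor_rel n t p q" if "q \<in> minor_grading n (n - t) d"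
    for d and q :: "(nat \<times> nat, 'k) mpolynomial"
    using minor_rel_in_grading[OF that] unfolding sym t(3) .
qed (fact minor_rel.intros)+

end
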